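(* Let $F\colon\mathscr D\to\mathscr E$ be a morphism of derivators with pseudo-naturality constraints $\gamma$, and let $p\colon K\to A$, $v\colon K\to M$, $u\colon A\to B$, $q\colon M\to B$ be functors between small categories together with a natural transformation $\alpha\colon u p\to q v$. Then the following diagram commutes: $$\begin{array}{ccc} F v_!p^* & \xrightarrow{\ \alpha_!\ } & F q^* u_!\\ \uparrow & & \uparrow{\scriptstyle\gamma,\ \cong}\\ v_!F p^* & & q^*F u_!\\ {\scriptstyle\gamma,\ \cong}\uparrow & & \uparrow\\ v_!p^*F & \xrightarrow{\ \alpha_!\ } & q^*u_!F \end{array}$$ where the horizontal morphisms are induced by the canonical mates $\alpha_!\colon v_!p^*\to q^*u_!$ in $\mathscr D$ and $\mathscr E$, and the two vertical morphisms not labelled by $\gamma$ are induced by the canonical mates $v_!F\to Fv_!$ and $u_!F\to Fu_!$.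
   Context: Derivators. $\mathrm{Cat}$ is the 2-category of small categories, $\mathrm{CAT}$ that of not necessarily small categories, $\mathbb 1$ the terminal category. A prederivator is a strict 2-functor $\mathscr D\colon\mathrm{Cat}^{\mathrm{op}}\to\mathrm{CAT}$ (1-cells reversed); write $u^*=\mathscr D(u)$ and $\alpha^*$ for the natural transformation induced by a natural transformation $\alpha$. It is a derivator if: (Der1) $\mathscr D(\coprod_i A_i)\to\prod_i\mathscr D(A_i)$ is an equivalence; (Der2) a morphism $f$ of $\mathscr D(A)$ is invertible iff $f_a:=a^*f$ is invertible for all objects $a\colon\mathbb 1\to A$; (Der3) every $u^*$ has a left adjoint $u_!$ and a right adjoint $u_*$; (Der4) for $u\colon A\to B$ and $b\in B$ the canonical maps $\operatorname{colim}_{(u/b)}p^*X\to (u_!X)_b$ and $(u_*X)_b\to\lim_{(b/u)}q^*X$ are isomorphisms, where here $p\colon(u/b)\to A$, $q\colon (b/u)\to A$ are the projections and $\operatorname{colim}_A=\pi_!$, $\lim_A=\pi_*$ for $\pi\colon A\to\mathbb 1$. A morphism of derivators $F\colon\mathscr D\to\mathscr E$ is a pseudo-natural transformation: functors $F=F_A\colon\mathscr D(A)\to\mathscr E(A)$ with coherent natural isomorphisms $\gamma=\gamma_u\colon u^*F\xrightarrow{\sim}Fu^*$ for all functors $u$. Canonical mates. In any derivator, $\alpha_!$ is the composite $v_!p^*\xrightarrow{\eta}v_!p^*u^*u_!\xrightarrow{\alpha^*}v_!v^*q^*u_!\xrightarrow{\varepsilon}q^*u_!$, where $\eta,\varepsilon$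 are the unit of $(u_!,u^* )$ and the counit of $(v_!,v^* )$. For a morphism $F$ and a functor $u$, the mate $u_!F\to Fu_!$ is the composite $u_!F\xrightarrow{\eta}u_!Fu^*u_!\xrightarrow{\gamma^{-1}}u_!u^*Fu_!\xrightarrow{\varepsilon}Fu_!$. *)

theory Defs
  imports Main "HOL-Library.FuncSet" "HOL-Library.Equipollence"
begin

section \<open>Categories, functors and natural transformations\<close>

text \<open>All structure maps are extensional (\<^const>\<open>undefined\<close> off the carrier), so that HOL
  equality of these records is equality of categories, functors and natural transformations; this is
  what makes strict 2-functoriality meaningful below.\<close>

record ('o, 'm) category =
  Obj :: "'o set"
  Arr :: "'m set"
  Dom :: "'m \<Rightarrow> 'o"
  Cod :: "'m \<Rightarrow> 'o"
  Id :: "'o \<Rightarrow> 'm"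
  Comp :: "'m \<Rightarrow> 'm \<Rightarrow> 'm"

definition hom :: "('o, 'm) category \<Rightarrow> 'o \<Rightarrow> 'o \<Rightarrow> 'm set" where
  "hom C x y = {f \<in> Arr C. Dom C f = x \<and> Cod C f = y}"

definition composable :: "('o, 'm) category \<Rightarrow> 'm \<Rightarrow> 'm \<Rightarrow> bool" where
  "composable C g f \<longleftrightarrow> g \<in> Arr C \<and> f \<in> Arr C \<and> Dom C g = Cod C f"

definition is_category :: "('o, 'm) category \<Rightarrow> bool" where
  "is_category C \<longleftrightarrow>
     Dom C \<in> Arr C \<rightarrow>\<^sub>E Obj C \<and> Cod C \<in> Arr C \<rightarrow>\<^sub>E Obj C \<and> Id C \<in> extensional (Obj C) \<and>
     (\<forall>x \<in> Obj C. Id C x \<in> hom C x x) \<and>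
     (\<forall>g f. composable C g f \<longrightarrow> Comp C g f \<in> hom C (Dom C f) (Cod C g)) \<and>
     (\<forall>g f. \<not> composable C g f \<longrightarrow> Comp C g f = undefined) \<and>
     (\<forall>f \<in> Arr C. Comp C f (Id C (Dom C f)) = f \<and> Comp C (Id C (Cod C f)) f = f) \<and>
     (\<forall>h g f. composable C h g \<and> composable C g f \<longrightarrow>
        Comp C h (Comp C g f) = Comp C (Comp C h g) f)"

definition mk_category ::
  "'o set \<Rightarrow> 'm set \<Rightarrow> ('m \<Rightarrow> 'o) \<Rightarrow> ('m \<Rightarrow> 'o) \<Rightarrow> ('o \<Rightarrow> 'm) \<Rightarrow> ('m \<Rightarrow> 'm \<Rightarrow> 'm) \<Rightarrow> ('o, 'm) category"
where
  "mk_category ob ar d c i m =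
     \<lparr>Obj = ob, Arr = ar, Dom = restrict d ar, Cod = restrict c ar, Id = restrict i ob,
      Comp = (\<lambda>g f. if g \<in> ar \<and> f \<in> ar \<and> d g = c f then m g f else undefined)\<rparr>"

definition inverse_arrows :: "('o, 'm) category \<Rightarrow> 'm \<Rightarrow> 'm \<Rightarrow> bool" where
  "inverse_arrows C f g \<longleftrightarrow> f \<in> Arr C \<and> g \<in> hom C (Cod C f) (Dom C f) \<and>
     Comp C g f = Id C (Dom C f) \<and> Comp C f g = Id C (Cod C f)"

definition is_iso :: "('o, 'm) category \<Rightarrow> 'm \<Rightarrow> bool" where
  "is_iso C f \<longleftrightarrow> (\<exists>g. inverse_arrows C f g)"

definition inv_arrow :: "('o, 'm) category \<Rightarrow> 'm \<Rightarrow> 'm" where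
  "inv_arrow C f = (THE g. inverse_arrows C f g)"

record ('o1, 'm1, 'o2, 'm2) cfunctor =
  Src :: "('o1, 'm1) category"
  Tgt :: "('o2, 'm2) category"
  OMap :: "'o1 \<Rightarrow> 'o2"
  AMap :: "'m1 \<Rightarrow> 'm2"

definition is_functor ::
  "('o1, 'm1, 'o2, 'm2) cfunctor \<Rightarrow> ('o1, 'm1) category \<Rightarrow> ('o2, 'm2) category \<Rightarrow> bool"
where
  "is_functor F C D \<longleftrightarrow>
     Src F = C \<and> Tgt F = D \<and> is_category C \<and> is_category D \<and>
     OMap F \<in> Obj C \<rightarrow>\<^sub>E Obj D \<and> AMap F \<in> extensional (Arr C) \<and>
     (\<forall>f \<in> Arr C. AMap F f \<in> hom D (OMap F (Dom C f)) (OMap F (Cod C f))) \<and>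
     (\<forall>x \<in> Obj C. AMap F (Id C x) = Id D (OMap F x)) \<and>
     (\<forall>g f. composable C g f \<longrightarrow> AMap F (Comp C g f) = Comp D (AMap F g) (AMap F f))"

definition mk_functor ::
  "('o1, 'm1) category \<Rightarrow> ('o2, 'm2) category \<Rightarrow> ('o1 \<Rightarrow> 'o2) \<Rightarrow> ('m1 \<Rightarrow> 'm2) \<Rightarrow>
   ('o1, 'm1, 'o2, 'm2) cfunctor"
where
  "mk_functor C D fo fa =
     \<lparr>Src = C, Tgt = D, OMap = restrict fo (Obj C), AMap = restrict fa (Arr C)\<rparr>"

definition fid :: "('o, 'm) category \<Rightarrow> ('o, 'm, 'o, 'm) cfunctor" where
  "fid C = mk_functor C C (\<lambda>x. x) (\<lambda>f. f)"

definition fcomp ::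
  "('o2, 'm2, 'o3, 'm3) cfunctor \<Rightarrow> ('o1, 'm1, 'o2, 'm2) cfunctor \<Rightarrow> ('o1, 'm1, 'o3, 'm3) cfunctor"
  (infixr "\<odot>" 80)
where
  "G \<odot> F = mk_functor (Src F) (Tgt G) (\<lambda>x. OMap G (OMap F x)) (\<lambda>f. AMap G (AMap F f))"

record ('o1, 'm1, 'o2, 'm2) nat_trans =
  NSrc :: "('o1, 'm1, 'o2, 'm2) cfunctor"
  NTgt :: "('o1, 'm1, 'o2, 'm2) cfunctor"
  Cmp :: "'o1 \<Rightarrow> 'm2"

definition is_nat ::
  "('o1, 'm1, 'o2, 'm2) nat_trans \<Rightarrow> ('o1, 'm1, 'o2, 'm2) cfunctor \<Rightarrow>
   ('o1, 'm1, 'o2, 'm2) cfunctor \<Rightarrow> bool"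
where
  "is_nat t F G \<longleftrightarrow>
     NSrc t = F \<and> NTgt t = G \<and>
     is_functor F (Src F) (Tgt F) \<and> is_functor G (Src F) (Tgt F) \<and>
     Cmp t \<in> extensional (Obj (Src F)) \<and>
     (\<forall>x \<in> Obj (Src F). Cmp t x \<in> hom (Tgt F) (OMap F x) (OMap G x)) \<and>
     (\<forall>f \<in> Arr (Src F).
        Comp (Tgt F) (Cmp t (Cod (Src F) f)) (AMap F f) =
        Comp (Tgt F) (AMap G f) (Cmp t (Dom (Src F) f)))"

definition mk_nat ::
  "('o1, 'm1, 'o2, 'm2) cfunctor \<Rightarrow> ('o1, 'm1, 'o2, 'm2) cfunctor \<Rightarrow> ('o1 \<Rightarrow> 'm2) \<Rightarrow>
   ('o1, 'm1, 'o2, 'm2) nat_trans"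
where
  "mk_nat F G c = \<lparr>NSrc = F, NTgt = G, Cmp = restrict c (Obj (Src F))\<rparr>"

definition nid :: "('o1, 'm1, 'o2, 'm2) cfunctor \<Rightarrow> ('o1, 'm1, 'o2, 'm2) nat_trans" where
  "nid F = mk_nat F F (\<lambda>x. Id (Tgt F) (OMap F x))"

definition vcomp ::
  "('o1, 'm1, 'o2, 'm2) nat_trans \<Rightarrow> ('o1, 'm1, 'o2, 'm2) nat_trans \<Rightarrow>
   ('o1, 'm1, 'o2, 'm2) nat_trans" (infixr "\<bullet>" 70)
where
  "t \<bullet> s = mk_nat (NSrc s) (NTgt t) (\<lambda>x. Comp (Tgt (NSrc s)) (Cmp t x) (Cmp s x))"

definition whisker_left ::
  "('o2, 'm2, 'o3, 'm3) cfunctor \<Rightarrow> ('o1, 'm1, 'o2, 'm2) nat_trans \<Rightarrow>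
   ('o1, 'm1, 'o3, 'm3) nat_trans" (infixr "\<lhd>" 75)
where
  "H \<lhd> t = mk_nat (H \<odot> NSrc t) (H \<odot> NTgt t) (\<lambda>x. AMap H (Cmp t x))"

definition whisker_right ::
  "('o2, 'm2, 'o3, 'm3) nat_trans \<Rightarrow> ('o1, 'm1, 'o2, 'm2) cfunctor \<Rightarrow>
   ('o1, 'm1, 'o3, 'm3) nat_trans" (infixl "\<rhd>" 75)
where
  "t \<rhd> K = mk_nat (NSrc t \<odot> K) (NTgt t \<odot> K) (\<lambda>x. Cmp t (OMap K x))"

definition hcomp ::
  "('o2, 'm2, 'o3, 'm3) nat_trans \<Rightarrow> ('o1, 'm1, 'o2, 'm2) nat_trans \<Rightarrow>
   ('o1, 'm1, 'o3, 'm3) nat_trans"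
where
  "hcomp t s = (t \<rhd> NTgt s) \<bullet> (NSrc t \<lhd> s)"

definition is_nat_iso ::
  "('o1, 'm1, 'o2, 'm2) nat_trans \<Rightarrow> ('o1, 'm1, 'o2, 'm2) cfunctor \<Rightarrow>
   ('o1, 'm1, 'o2, 'm2) cfunctor \<Rightarrow> bool"
where
  "is_nat_iso t F G \<longleftrightarrow> is_nat t F G \<and> (\<forall>x \<in> Obj (Src F). is_iso (Tgt F) (Cmp t x))"

definition ninv :: "('o1, 'm1, 'o2, 'm2) nat_trans \<Rightarrow> ('o1, 'm1, 'o2, 'm2) nat_trans" where
  "ninv t = mk_nat (NTgt t) (NSrc t) (\<lambda>x. inv_arrow (Tgt (NSrc t)) (Cmp t x))"

definition is_equivalence ::
  "('o1, 'm1, 'o2, 'm2) cfunctor \<Rightarrow> ('o1, 'm1) category \<Rightarrow> ('o2, 'm2) category \<Rightarrow> bool"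
where
  "is_equivalence F C D \<longleftrightarrow> is_functor F C D \<and>
     (\<exists>G s t. is_functor G D C \<and> is_nat_iso s (fid C) (G \<odot> F) \<and> is_nat_iso t (F \<odot> G) (fid D))"

record ('o1, 'm1, 'o2, 'm2) adjunction =
  Lft :: "('o1, 'm1, 'o2, 'm2) cfunctor"
  Rgt :: "('o2, 'm2, 'o1, 'm1) cfunctor"
  Unit :: "('o1, 'm1, 'o1, 'm1) nat_trans"
  Counit :: "('o2, 'm2, 'o2, 'm2) nat_trans"

definition is_adjunction :: "('o1, 'm1, 'o2, 'm2) adjunction \<Rightarrow> bool" where
  "is_adjunction S \<longleftrightarrow>
     is_functor (Lft S) (Src (Lft S)) (Tgt (Lft S)) \<and>
     is_functor (Rgt S) (Tgt (Lft S)) (Src (Lft S)) \<and>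
     is_nat (Unit S) (fid (Src (Lft S))) (Rgt S \<odot> Lft S) \<and>
     is_nat (Counit S) (Lft S \<odot> Rgt S) (fid (Tgt (Lft S))) \<and>
     (Counit S \<rhd> Lft S) \<bullet> (Lft S \<lhd> Unit S) = nid (Lft S) \<and>
     (Rgt S \<lhd> Counit S) \<bullet> (Unit S \<rhd> Rgt S) = nid (Rgt S)"

definition prod_category ::
  "'i set \<Rightarrow> ('i \<Rightarrow> ('o, 'm) category) \<Rightarrow> ('i \<Rightarrow> 'o, 'i \<Rightarrow> 'm) category"
where
  "prod_category I C = mk_category (\<Pi>\<^sub>E i\<in>I. Obj (C i)) (\<Pi>\<^sub>E i\<in>I. Arr (C i))
     (\<lambda>f. \<lambda>i\<in>I. Dom (C i) (f i)) (\<lambda>f. \<lambda>i\<in>I. Cod (C i) (f i))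
     (\<lambda>x. \<lambda>i\<in>I. Id (C i) (x i)) (\<lambda>g f. \<lambda>i\<in>I. Comp (C i) (g i) (f i))"

definition coprod_category ::
  "'i set \<Rightarrow> ('i \<Rightarrow> ('o, 'm) category) \<Rightarrow> ('i \<times> 'o, 'i \<times> 'm) category"
where
  "coprod_category I C = mk_category (SIGMA i:I. Obj (C i)) (SIGMA i:I. Arr (C i))
     (\<lambda>(i, f). (i, Dom (C i) f)) (\<lambda>(i, f). (i, Cod (C i) f))
     (\<lambda>(i, x). (i, Id (C i) x)) (\<lambda>(i, g) (j, f). (i, Comp (C i) g f))"

definition coprod_inj ::
  "'i set \<Rightarrow> ('i \<Rightarrow> ('o, 'm) category) \<Rightarrow> 'i \<Rightarrow> ('o, 'm, 'i \<times> 'o, 'i \<times> 'm) cfunctor"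
where
  "coprod_inj I C i = mk_functor (C i) (coprod_category I C) (Pair i) (Pair i)"

text \<open>The comma categories \<open>u/b\<close> (objects \<open>(a, f : u a \<rightarrow> b)\<close>) and \<open>b/u\<close> (objects
  \<open>(a, f : b \<rightarrow> u a)\<close>). An arrow \<open>(x, g, y)\<close> is \<open>g\<close> together with its source \<open>x\<close> and its target \<open>y\<close>.\<close>

definition over_category ::
  "('o1, 'm1, 'o2, 'm2) cfunctor \<Rightarrow> 'o2 \<Rightarrow>
   ('o1 \<times> 'm2, ('o1 \<times> 'm2) \<times> 'm1 \<times> ('o1 \<times> 'm2)) category"
where
  "over_category u b =
     (let ob = (SIGMA a:Obj (Src u). hom (Tgt u) (OMap u a) b) in
      mk_category ob
        {(x, g, y). x \<in> ob \<and> y \<in> ob \<and> g \<in> hom (Src u) (fst x) (fst y) \<and>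
                    Comp (Tgt u) (snd y) (AMap u g) = snd x}
        (\<lambda>(x, g, y). x) (\<lambda>(x, g, y). y) (\<lambda>x. (x, Id (Src u) (fst x), x))
        (\<lambda>(y, h, z) (x, g, y'). (x, Comp (Src u) h g, z)))"

definition under_category ::
  "'o2 \<Rightarrow> ('o1, 'm1, 'o2, 'm2) cfunctor \<Rightarrow>
   ('o1 \<times> 'm2, ('o1 \<times> 'm2) \<times> 'm1 \<times> ('o1 \<times> 'm2)) category"
where
  "under_category b u =
     (let ob = (SIGMA a:Obj (Src u). hom (Tgt u) b (OMap u a)) in
      mk_category ob
        {(x, g, y). x \<in> ob \<and> y \<in> ob \<and> g \<in> hom (Src u) (fst x) (fst y) \<and>
                    Comp (Tgt u) (AMap u g) (snd x) = snd y}
        (\<lambda>(x, g, y). x) (\<lambda>(x, g, y). y) (\<lambda>x. (x, Id (Src u) (fst x), x))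
        (\<lambda>(y, h, z) (x, g, y'). (x, Comp (Src u) h g, z)))"

section \<open>Small categories\<close>

text \<open>A type \<open>'s\<close> of class \<open>universe\<close> plays the role of the class of all sets: its cardinality is a
  regular strong limit cardinal, and a collection is small iff it has fewer elements than \<open>'s\<close>.
  Every Grothendieck universe is an instance. Uncountability is not required, so that HOL itself
  provides an instance, namely \<^typ>\<open>nat\<close> (where small means finite).\<close>

class universe =
  assumes universe_infinite: "infinite (UNIV :: 'a set)"
    and universe_regular:
      "\<And>(I :: 'a set) (X :: 'a \<Rightarrow> 'a set).
         I \<prec> (UNIV :: 'a set) \<Longrightarrow> (\<And>i. i \<in> I \<Longrightarrow> X i \<prec> (UNIV :: 'a set)) \<Longrightarrow>
         (\<Union>i\<in>I. X i) \<prec> (UNIV :: 'a set)"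
    and universe_strong_limit:
      "\<And>X :: 'a set. X \<prec> (UNIV :: 'a set) \<Longrightarrow> Pow X \<prec> (UNIV :: 'a set)"

lemma lesspoll_UNIV_nat_iff: "A \<prec> (UNIV :: nat set) \<longleftrightarrow> finite A"
  by (metis finite_lesspoll_infinite infinite_UNIV_nat infinite_le_lepoll lesspoll_def
      lepoll_antisym)

instance nat :: universe
  by standard (auto simp: lesspoll_UNIV_nat_iff)

definition small_category :: "('s::universe, 's) category \<Rightarrow> bool" where
  "small_category A \<longleftrightarrow>
     is_category A \<and> Obj A \<prec> (UNIV :: 's set) \<and> Arr A \<prec> (UNIV :: 's set)"

definition small_functor ::
  "('s::universe, 's, 's, 's) cfunctor \<Rightarrow> ('s, 's) category \<Rightarrow> ('s, 's) category \<Rightarrow> bool"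
where
  "small_functor u A B \<longleftrightarrow> small_category A \<and> small_category B \<and> is_functor u A B"

text \<open>Coproducts and comma categories of small categories have tuples as objects and arrows; they are
  made into categories with underlying type \<open>'s\<close> by means of an injection of the type of tuples
  into \<open>'s\<close>, which exists because \<open>'s\<close> is infinite.\<close>

definition code :: "'x \<Rightarrow> 's::universe" where
  "code = (SOME f. inj f)"

definition decode :: "'s::universe \<Rightarrow> 'x" where
  "decode = inv code"

definition small_copy :: "('o, 'm) category \<Rightarrow> ('s::universe, 's) category" where
  "small_copy C = mk_category (code ` Obj C) (code ` Arr C)
     (\<lambda>f. code (Dom C (decode f))) (\<lambda>f. code (Cod C (decode f)))
     (\<lambda>x. code (Id C (decode x))) (\<lambda>g f. code (Comp C (decode g) (decode f)))"

definition to_copy :: "('o, 'm) category \<Rightarrow> ('o, 'm, 's::universe, 's) cfunctor" where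
  "to_copy C = mk_functor C (small_copy C) code code"

definition from_copy :: "('o, 'm) category \<Rightarrow> ('s::universe, 's, 'o, 'm) cfunctor" where
  "from_copy C = mk_functor (small_copy C) C decode decode"

definition one_category :: "('s::universe, 's) category" where
  "one_category = mk_category {undefined} {undefined}
     (\<lambda>_. undefined) (\<lambda>_. undefined) (\<lambda>_. undefined) (\<lambda>_ _. undefined)"

definition to_one :: "('s::universe, 's) category \<Rightarrow> ('s, 's, 's, 's) cfunctor" where
  "to_one A = mk_functor A one_category (\<lambda>_. undefined) (\<lambda>_. undefined)"

definition point :: "('s::universe, 's) category \<Rightarrow> 's \<Rightarrow> ('s, 's, 's, 's) cfunctor" where
  "point A a = mk_functor one_category A (\<lambda>_. a) (\<lambda>_. Id A a)"

definition small_coprod :: "'s set \<Rightarrow> ('s \<Rightarrow> ('s, 's) category) \<Rightarrow> ('s::universe, 's) category" where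
  "small_coprod I A = small_copy (coprod_category I A)"

definition small_coprod_inj ::
  "'s set \<Rightarrow> ('s \<Rightarrow> ('s, 's) category) \<Rightarrow> 's \<Rightarrow> ('s::universe, 's, 's, 's) cfunctor"
where
  "small_coprod_inj I A i = to_copy (coprod_category I A) \<odot> coprod_inj I A i"

definition over :: "('s::universe, 's, 's, 's) cfunctor \<Rightarrow> 's \<Rightarrow> ('s, 's) category" where
  "over u b = small_copy (over_category u b)"

definition over_proj :: "('s::universe, 's, 's, 's) cfunctor \<Rightarrow> 's \<Rightarrow> ('s, 's, 's, 's) cfunctor" where
  "over_proj u b =
     mk_functor (over_category u b) (Src u) fst (\<lambda>(x, g, y). g) \<odot> from_copy (over_category u b)"

definition over_cell :: "('s::universe, 's, 's, 's) cfunctor \<Rightarrow> 's \<Rightarrow> ('s, 's, 's, 's) nat_trans" where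
  "over_cell u b = mk_nat (u \<odot> over_proj u b) (point (Tgt u) b \<odot> to_one (over u b))
     (\<lambda>x. snd (decode x :: 's \<times> 's))"

definition under :: "'s \<Rightarrow> ('s::universe, 's, 's, 's) cfunctor \<Rightarrow> ('s, 's) category" where
  "under b u = small_copy (under_category b u)"

definition under_proj :: "'s \<Rightarrow> ('s::universe, 's, 's, 's) cfunctor \<Rightarrow> ('s, 's, 's, 's) cfunctor" where
  "under_proj b u =
     mk_functor (under_category b u) (Src u) fst (\<lambda>(x, g, y). g) \<odot> from_copy (under_category b u)"

definition under_cell :: "'s \<Rightarrow> ('s::universe, 's, 's, 's) cfunctor \<Rightarrow> ('s, 's, 's, 's) nat_trans" where
  "under_cell b u = mk_nat (point (Tgt u) b \<odot> to_one (under b u)) (u \<odot> under_proj b u)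
     (\<lambda>x. snd (decode x :: 's \<times> 's))"

section \<open>Derivators\<close>

record ('s, 'o, 'm) prederivator =
  DCat :: "('s, 's) category \<Rightarrow> ('o, 'm) category"
  DFun :: "('s, 's, 's, 's) cfunctor \<Rightarrow> ('o, 'm, 'o, 'm) cfunctor"
  DNat :: "('s, 's, 's, 's) nat_trans \<Rightarrow> ('o, 'm, 'o, 'm) nat_trans"

definition is_prederivator :: "('s::universe, 'o, 'm) prederivator \<Rightarrow> bool" where
  "is_prederivator \<D> \<longleftrightarrow>
     (\<forall>A. small_category A \<longrightarrow> is_category (DCat \<D> A)) \<and>
     (\<forall>u A B. small_functor u A B \<longrightarrow> is_functor (DFun \<D> u) (DCat \<D> B) (DCat \<D> A)) \<and>
     (\<forall>u u' A B s. small_functor u A B \<and> small_functor u' A B \<and> is_nat s u u' \<longrightarrow>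
        is_nat (DNat \<D> s) (DFun \<D> u) (DFun \<D> u')) \<and>
     (\<forall>A. small_category A \<longrightarrow> DFun \<D> (fid A) = fid (DCat \<D> A)) \<and>
     (\<forall>u v A B C. small_functor u A B \<and> small_functor v B C \<longrightarrow>
        DFun \<D> (v \<odot> u) = DFun \<D> u \<odot> DFun \<D> v) \<and>
     (\<forall>u A B. small_functor u A B \<longrightarrow> DNat \<D> (nid u) = nid (DFun \<D> u)) \<and>
     (\<forall>u u' u'' A B s t. small_functor u A B \<and> small_functor u' A B \<and> small_functor u'' A B \<and>
        is_nat s u u' \<and> is_nat t u' u'' \<longrightarrow> DNat \<D> (t \<bullet> s) = DNat \<D> t \<bullet> DNat \<D> s) \<and>
     (\<forall>u u' v v' A B C s t. small_functor u A B \<and> small_functor u' A B \<and>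
        small_functor v B C \<and> small_functor v' B C \<and> is_nat s u u' \<and> is_nat t v v' \<longrightarrow>
        DNat \<D> (hcomp t s) = hcomp (DNat \<D> s) (DNat \<D> t))"

text \<open>A choice of \<open>u\<^sub>!\<close> (resp. \<open>u\<^sub>*\<close>) is an adjunction whose right (resp. left) adjoint is \<open>u\<^sup>*\<close>.\<close>

definition left_kan ::
  "('s::universe, 'o, 'm) prederivator \<Rightarrow> ('s, 's, 's, 's) cfunctor \<Rightarrow> ('o, 'm, 'o, 'm) adjunction \<Rightarrow>
   bool"
where
  "left_kan \<D> u S \<longleftrightarrow> is_adjunction S \<and> Rgt S = DFun \<D> u"

definition right_kan ::
  "('s::universe, 'o, 'm) prederivator \<Rightarrow> ('s, 's, 's, 's) cfunctor \<Rightarrow> ('o, 'm, 'o, 'm) adjunction \<Rightarrow>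
   bool"
where
  "right_kan \<D> u S \<longleftrightarrow> is_adjunction S \<and> Lft S = DFun \<D> u"

text \<open>For \<open>\<alpha> : u p \<rightarrow> q v\<close> the mate \<open>\<alpha>\<^sub>! : v\<^sub>! p\<^sup>* \<rightarrow> q\<^sup>* u\<^sub>!\<close>, formed with the choices \<open>Su\<close>, \<open>Sv\<close> of
  \<open>u\<^sub>!\<close>, \<open>v\<^sub>!\<close>; dually, for \<open>\<alpha> : q v \<rightarrow> u p\<close> the mate \<open>\<alpha>\<^sub>* : q\<^sup>* u\<^sub>* \<rightarrow> v\<^sub>* p\<^sup>*\<close>.\<close>

definition left_mate ::
  "('s::universe, 'o, 'm) prederivator \<Rightarrow> ('o, 'm, 'o, 'm) adjunction \<Rightarrow> ('o, 'm, 'o, 'm) adjunction \<Rightarrow>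
   ('s, 's, 's, 's) cfunctor \<Rightarrow> ('s, 's, 's, 's) cfunctor \<Rightarrow> ('s, 's, 's, 's) nat_trans \<Rightarrow>
   ('o, 'm, 'o, 'm) nat_trans"
where
  "left_mate \<D> Su Sv p q \<alpha> =
     (Counit Sv \<rhd> (DFun \<D> q \<odot> Lft Su)) \<bullet>
     ((Lft Sv \<lhd> DNat \<D> \<alpha>) \<rhd> Lft Su) \<bullet>
     ((Lft Sv \<odot> DFun \<D> p) \<lhd> Unit Su)"

definition right_mate ::
  "('s::universe, 'o, 'm) prederivator \<Rightarrow> ('o, 'm, 'o, 'm) adjunction \<Rightarrow> ('o, 'm, 'o, 'm) adjunction \<Rightarrow>
   ('s, 's, 's, 's) cfunctor \<Rightarrow> ('s, 's, 's, 's) cfunctor \<Rightarrow> ('s, 's, 's, 's) nat_trans \<Rightarrow>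
   ('o, 'm, 'o, 'm) nat_trans"
where
  "right_mate \<D> Su Sv p q \<alpha> =
     ((Rgt Sv \<odot> DFun \<D> p) \<lhd> Counit Su) \<bullet>
     ((Rgt Sv \<lhd> DNat \<D> \<alpha>) \<rhd> Rgt Su) \<bullet>
     (Unit Sv \<rhd> (DFun \<D> q \<odot> Rgt Su))"

definition der1 :: "('s::universe, 'o, 'm) prederivator \<Rightarrow> bool" where
  "der1 \<D> \<longleftrightarrow>
     (\<forall>(I :: 's set) A. I \<prec> (UNIV :: 's set) \<and> (\<forall>i\<in>I. small_category (A i)) \<longrightarrow>
        (let P = prod_category I (\<lambda>i. DCat \<D> (A i)); Q = DCat \<D> (small_coprod I A) in
         is_equivalence
           (mk_functor Q P
             (\<lambda>X. \<lambda>i\<in>I. OMap (DFun \<D> (small_coprod_inj I A i)) X)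
             (\<lambda>f. \<lambda>i\<in>I. AMap (DFun \<D> (small_coprod_inj I A i)) f)) Q P))"

definition der2 :: "('s::universe, 'o, 'm) prederivator \<Rightarrow> bool" where
  "der2 \<D> \<longleftrightarrow>
     (\<forall>A. small_category A \<longrightarrow> (\<forall>f \<in> Arr (DCat \<D> A).
        is_iso (DCat \<D> A) f \<longleftrightarrow>
        (\<forall>a \<in> Obj A. is_iso (DCat \<D> one_category) (AMap (DFun \<D> (point A a)) f))))"

definition der3 :: "('s::universe, 'o, 'm) prederivator \<Rightarrow> bool" where
  "der3 \<D> \<longleftrightarrow>
     (\<forall>u A B. small_functor u A B \<longrightarrow> (\<exists>S. left_kan \<D> u S) \<and> (\<exists>S. right_kan \<D> u S))"

text \<open>The canonical maps of Der4 are the mates of the comma squares; whether they are invertible does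
  not depend on the choice of the adjoints.\<close>

definition der4 :: "('s::universe, 'o, 'm) prederivator \<Rightarrow> bool" where
  "der4 \<D> \<longleftrightarrow>
     (\<forall>u A B b. small_functor u A B \<and> b \<in> Obj B \<longrightarrow>
        (\<forall>Su Sc. left_kan \<D> u Su \<and> left_kan \<D> (to_one (over u b)) Sc \<longrightarrow>
           (\<forall>X \<in> Obj (DCat \<D> A). is_iso (DCat \<D> one_category)
              (Cmp (left_mate \<D> Su Sc (over_proj u b) (point B b) (over_cell u b)) X))) \<and>
        (\<forall>Su Sl. right_kan \<D> u Su \<and> right_kan \<D> (to_one (under b u)) Sl \<longrightarrow>
           (\<forall>X \<in> Obj (DCat \<D> A). is_iso (DCat \<D> one_category)
              (Cmp (right_mate \<D> Su Sl (under_proj b u) (point B b) (under_cell b u)) X))))"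

definition derivator :: "('s::universe, 'o, 'm) prederivator \<Rightarrow> bool" where
  "derivator \<D> \<longleftrightarrow> is_prederivator \<D> \<and> der1 \<D> \<and> der2 \<D> \<and> der3 \<D> \<and> der4 \<D>"

section \<open>Morphisms of derivators\<close>

record ('s, 'o1, 'm1, 'o2, 'm2) der_morphism =
  MFun :: "('s, 's) category \<Rightarrow> ('o1, 'm1, 'o2, 'm2) cfunctor"
  MNat :: "('s, 's, 's, 's) cfunctor \<Rightarrow> ('o1, 'm1, 'o2, 'm2) nat_trans"

definition is_der_morphism ::
  "('s::universe, 'o1, 'm1, 'o2, 'm2) der_morphism \<Rightarrow>
   ('s, 'o1, 'm1) prederivator \<Rightarrow> ('s, 'o2, 'm2) prederivator \<Rightarrow> bool"
where
  "is_der_morphism F \<D> \<E> \<longleftrightarrow>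
     (\<forall>A. small_category A \<longrightarrow> is_functor (MFun F A) (DCat \<D> A) (DCat \<E> A)) \<and>
     (\<forall>u A B. small_functor u A B \<longrightarrow>
        is_nat_iso (MNat F u) (DFun \<E> u \<odot> MFun F B) (MFun F A \<odot> DFun \<D> u)) \<and>
     (\<forall>A. small_category A \<longrightarrow> MNat F (fid A) = nid (MFun F A)) \<and>
     (\<forall>u v A B C. small_functor u A B \<and> small_functor v B C \<longrightarrow>
        MNat F (v \<odot> u) = (MNat F u \<rhd> DFun \<D> v) \<bullet> (DFun \<E> u \<lhd> MNat F v)) \<and>
     (\<forall>u u' A B s. small_functor u A B \<and> small_functor u' A B \<and> is_nat s u u' \<longrightarrow>
        MNat F u' \<bullet> (DNat \<E> s \<rhd> MFun F B) = (MFun F A \<lhd> DNat \<D> s) \<bullet> MNat F u)"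

text \<open>The mate \<open>u\<^sub>! F \<rightarrow> F u\<^sub>!\<close> for \<open>u : A \<rightarrow> B\<close>, formed with the choices \<open>S\<close>, \<open>T\<close> of \<open>u\<^sub>!\<close> in the source
  and in the target of \<open>F\<close>.\<close>

definition morphism_mate ::
  "('s::universe, 'o1, 'm1, 'o2, 'm2) der_morphism \<Rightarrow>
   ('o1, 'm1, 'o1, 'm1) adjunction \<Rightarrow> ('o2, 'm2, 'o2, 'm2) adjunction \<Rightarrow>
   ('s, 's, 's, 's) cfunctor \<Rightarrow> ('o1, 'm1, 'o2, 'm2) nat_trans"
where
  "morphism_mate F S T u =
     (Counit T \<rhd> (MFun F (Tgt u) \<odot> Lft S)) \<bullet>
     ((Lft T \<lhd> ninv (MNat F u)) \<rhd> Lft S) \<bullet>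
     ((Lft T \<odot> MFun F (Src u)) \<lhd> Unit S)"

end

theory Submission imports Defs begin

text \<open>Both kinds of canonical mates are instances of one construction: a transformation
  \<open>t : P R \<rightarrow> R' Q\<close> between right adjoints gives \<open>L' P \<rightarrow> Q L\<close>, whose component at \<open>x\<close> is the transpose
  under \<open>L' \<stileturn> R'\<close> of \<open>P x \<rightarrow> P R L x \<rightarrow> R' Q L x\<close>. Evaluate the two composites of the diagram at an
  object and transpose them under \<open>v\<^sub>! \<stileturn> v\<^sup>*\<close>. By the triangle identities all units and counits except
  the unit \<open>\<eta> : 1 \<rightarrow> u\<^sup>* u\<^sub>!\<close> of \<open>\<D>\<close> disappear, and what remains is the compatibility of \<open>\<gamma>\<close> with
  \<open>\<alpha>\<close> and with the composites \<open>u p\<close> and \<open>q v\<close>.\<close>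

section \<open>Arrows, functors and transformations\<close>

lemma hom_objs:
  assumes "is_category C" "f \<in> hom C x y"
  shows "x \<in> Obj C" "y \<in> Obj C"
  using assms by (auto simp: is_category_def hom_def)

lemma Id_hom: "is_category C \<Longrightarrow> x \<in> Obj C \<Longrightarrow> Id C x \<in> hom C x x"
  by (auto simp: is_category_def)

lemma Comp_hom:
  assumes "is_category C" "f \<in> hom C x y" "g \<in> hom C y z"
  shows "Comp C g f \<in> hom C x z"
  using assms unfolding is_category_def hom_def composable_def by auto

lemma Comp_assoc:
  assumes "is_category C" "f \<in> hom C x y" "g \<in> hom C y z" "h \<in> hom C z w"
  shows "Comp C (Comp C h g) f = Comp C h (Comp C g f)"
  using assms unfolding is_category_def hom_def composable_def by auto

lemma Comp_Id:
  assumes "is_category C" "f \<in> hom C x y"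
  shows "Comp C f (Id C x) = f" "Comp C (Id C y) f = f"
  using assms unfolding is_category_def hom_def by auto

lemma inverse_arrows_unique:
  assumes "is_category C" "inverse_arrows C f g" "inverse_arrows C f h"
  shows "g = h"
proof -
  have "f \<in> hom C (Dom C f) (Cod C f)" "g \<in> hom C (Cod C f) (Dom C f)" "h \<in> hom C (Cod C f) (Dom C f)"
    using assms by (auto simp: inverse_arrows_def hom_def)
  then show ?thesis
    using assms Comp_assoc[of C h _ _ f _ g] Comp_Id[of C]
    by (metis inverse_arrows_def)
qed

lemma inv_arrow:
  assumes "is_category C" "is_iso C f" "f \<in> hom C x y"
  shows "inv_arrow C f \<in> hom C y x" "Comp C (inv_arrow C f) f = Id C x"
    "Comp C f (inv_arrow C f) = Id C y"
proof -
  have "inverse_arrows C f (inv_arrow C f)"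
    using assms(2) unfolding inv_arrow_def is_iso_def
    by (metis inverse_arrows_unique[OF assms(1)] theI)
  then show "inv_arrow C f \<in> hom C y x" "Comp C (inv_arrow C f) f = Id C x"
    "Comp C f (inv_arrow C f) = Id C y"
    using assms(3) by (auto simp: inverse_arrows_def hom_def)
qed

lemma functor_cat:
  assumes "is_functor F C D"
  shows "Src F = C" "Tgt F = D" "is_category C" "is_category D"
  using assms by (auto simp: is_functor_def)

lemma functor_obj: "is_functor F C D \<Longrightarrow> x \<in> Obj C \<Longrightarrow> OMap F x \<in> Obj D"
  by (auto simp: is_functor_def)

lemma functor_hom:
  "is_functor F C D \<Longrightarrow> f \<in> hom C x y \<Longrightarrow> AMap F f \<in> hom D (OMap F x) (OMap F y)"
  by (auto simp: is_functor_def hom_def)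

lemma functor_Comp:
  "is_functor F C D \<Longrightarrow> f \<in> hom C x y \<Longrightarrow> g \<in> hom C y z \<Longrightarrow>
    AMap F (Comp C g f) = Comp D (AMap F g) (AMap F f)"
  by (auto simp: is_functor_def hom_def composable_def)

lemma functor_Id: "is_functor F C D \<Longrightarrow> x \<in> Obj C \<Longrightarrow> AMap F (Id C x) = Id D (OMap F x)"
  by (auto simp: is_functor_def)

lemma fcomp_simps [simp]:
  "Src (G \<odot> F) = Src F" "Tgt (G \<odot> F) = Tgt G"
  "x \<in> Obj (Src F) \<Longrightarrow> OMap (G \<odot> F) x = OMap G (OMap F x)"
  "f \<in> Arr (Src F) \<Longrightarrow> AMap (G \<odot> F) f = AMap G (AMap F f)"
  by (auto simp: fcomp_def mk_functor_def)

lemma fid_simps [simp]: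
  "Src (fid C) = C" "Tgt (fid C) = C"
  "x \<in> Obj C \<Longrightarrow> OMap (fid C) x = x" "f \<in> Arr C \<Longrightarrow> AMap (fid C) f = f"
  by (auto simp: fid_def mk_functor_def)

lemma fcomp_functor:
  assumes "is_functor F C D" "is_functor G D E"
  shows "is_functor (G \<odot> F) C E"
proof -
  have C: "is_category C" "Src F = C" "Tgt G = E" using assms by (auto dest: functor_cat)
  show ?thesis
    unfolding is_functor_def
  proof (intro conjI ballI allI impI)
    show "OMap (G \<odot> F) \<in> Obj C \<rightarrow>\<^sub>E Obj E" "AMap (G \<odot> F) \<in> extensional (Arr C)"
      using assms C by (auto simp: fcomp_def mk_functor_def functor_obj)
    fix f assume "f \<in> Arr C"
    moreover from this have "f \<in> hom C (Dom C f) (Cod C f)" by (simp add: hom_def)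
    ultimately show "AMap (G \<odot> F) f \<in> hom E (OMap (G \<odot> F) (Dom C f)) (OMap (G \<odot> F) (Cod C f))"
      using assms C hom_objs[OF C(1), of f] by (simp add: functor_hom)
  next
    fix x assume "x \<in> Obj C"
    moreover from this have "Id C x \<in> Arr C" using Id_hom[OF C(1)] by (auto simp: hom_def)
    ultimately show "AMap (G \<odot> F) (Id C x) = Id E (OMap (G \<odot> F) x)"
      using assms C by (simp add: functor_Id functor_obj)
  next
    fix g f assume gf: "composable C g f"
    then have h: "f \<in> hom C (Dom C f) (Cod C f)" "g \<in> hom C (Cod C f) (Cod C g)"
      by (auto simp: hom_def composable_def)
    have "Comp C g f \<in> Arr C" "f \<in> Arr C" "g \<in> Arr C"
      using Comp_hom[OF C(1) h] h by (auto simp: hom_def)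
    then show "AMap (G \<odot> F) (Comp C g f) = Comp E (AMap (G \<odot> F) g) (AMap (G \<odot> F) f)"
      using C functor_Comp[OF assms(1) h]
        functor_Comp[OF assms(2) functor_hom[OF assms(1) h(1)] functor_hom[OF assms(1) h(2)]]
      by simp
  qed (use assms C in \<open>auto dest: functor_cat\<close>)
qed

lemma fcomp_assoc:
  assumes "is_functor F C D" "is_functor G D E"
  shows "(H \<odot> G) \<odot> F = H \<odot> (G \<odot> F)"
  using assms by (auto simp: fcomp_def mk_functor_def is_functor_def hom_def restrict_def fun_eq_iff)

lemma fid_fcomp: "is_functor F C D \<Longrightarrow> fid D \<odot> F = F"
  by (cases F) (auto simp: fid_def fcomp_def mk_functor_def is_functor_def hom_def fun_eq_iff
      extensional_def PiE_def Pi_def)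

lemma fcomp_fid: "is_functor F C D \<Longrightarrow> F \<odot> fid C = F"
  by (cases F) (auto simp: fid_def fcomp_def mk_functor_def is_functor_def hom_def fun_eq_iff
      extensional_def PiE_def Pi_def)

lemma mk_nat_simps [simp]:
  "NSrc (mk_nat F G c) = F" "NTgt (mk_nat F G c) = G"
  "x \<in> Obj (Src F) \<Longrightarrow> Cmp (mk_nat F G c) x = c x"
  by (auto simp: mk_nat_def)

lemma vcomp_simps [simp]:
  "NSrc (t \<bullet> s) = NSrc s" "NTgt (t \<bullet> s) = NTgt t"
  "x \<in> Obj (Src (NSrc s)) \<Longrightarrow> Cmp (t \<bullet> s) x = Comp (Tgt (NSrc s)) (Cmp t x) (Cmp s x)"
  by (auto simp: vcomp_def)

lemma whisker_left_simps [simp]: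
  "NSrc (H \<lhd> t) = H \<odot> NSrc t" "NTgt (H \<lhd> t) = H \<odot> NTgt t"
  "x \<in> Obj (Src (NSrc t)) \<Longrightarrow> Cmp (H \<lhd> t) x = AMap H (Cmp t x)"
  by (auto simp: whisker_left_def)

lemma whisker_right_simps [simp]:
  "NSrc (t \<rhd> K) = NSrc t \<odot> K" "NTgt (t \<rhd> K) = NTgt t \<odot> K"
  "x \<in> Obj (Src K) \<Longrightarrow> Cmp (t \<rhd> K) x = Cmp t (OMap K x)"
  by (auto simp: whisker_right_def)

lemma vcomp_eqI:
  assumes "NSrc s = NSrc s'" "NTgt t = NTgt t'"
    and "\<And>x. x \<in> Obj (Src (NSrc s)) \<Longrightarrow> Cmp (t \<bullet> s) x = Cmp (t' \<bullet> s') x"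
  shows "t \<bullet> s = t' \<bullet> s'"
  using assms by (auto simp: vcomp_def mk_nat_def restrict_def fun_eq_iff)

lemma nat_simps:
  assumes "is_nat t F G"
  shows "NSrc t = F" "NTgt t = G"
  using assms by (auto simp: is_nat_def)

lemma nat_hom:
  "is_nat t F G \<Longrightarrow> x \<in> Obj (Src F) \<Longrightarrow> Cmp t x \<in> hom (Tgt F) (OMap F x) (OMap G x)"
  by (auto simp: is_nat_def)

lemma nat_natural:
  "is_nat t F G \<Longrightarrow> f \<in> hom (Src F) x y \<Longrightarrow>
    Comp (Tgt F) (Cmp t y) (AMap F f) = Comp (Tgt F) (AMap G f) (Cmp t x)"
  by (auto simp: is_nat_def hom_def)

lemma ninv_simps [simp]:
  "NSrc (ninv t) = NTgt t" "NTgt (ninv t) = NSrc t"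
  "x \<in> Obj (Src (NTgt t)) \<Longrightarrow> Cmp (ninv t) x = inv_arrow (Tgt (NSrc t)) (Cmp t x)"
  by (auto simp: ninv_def)

lemma ninv_Cmp:
  assumes "is_nat_iso t F G" "x \<in> Obj (Src F)"
  shows "Cmp (ninv t) x \<in> hom (Tgt F) (OMap G x) (OMap F x)"
    "Comp (Tgt F) (Cmp (ninv t) x) (Cmp t x) = Id (Tgt F) (OMap F x)"
    "Comp (Tgt F) (Cmp t x) (Cmp (ninv t) x) = Id (Tgt F) (OMap G x)"
proof -
  have t: "is_nat t F G" and iso: "is_iso (Tgt F) (Cmp t x)"
    using assms by (auto simp: is_nat_iso_def)
  have "Src G = Src F" "is_category (Tgt F)" using t by (auto simp: is_nat_def is_functor_def)
  with inv_arrow[OF _ iso nat_hom[OF t assms(2)]] assms(2)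
  show "Cmp (ninv t) x \<in> hom (Tgt F) (OMap G x) (OMap F x)"
    "Comp (Tgt F) (Cmp (ninv t) x) (Cmp t x) = Id (Tgt F) (OMap F x)"
    "Comp (Tgt F) (Cmp t x) (Cmp (ninv t) x) = Id (Tgt F) (OMap G x)"
    by (simp_all add: nat_simps[OF t])
qed

lemma ninv_nat:
  assumes "is_nat_iso t F G"
  shows "is_nat (ninv t) G F"
proof -
  have t: "is_nat t F G" using assms by (simp add: is_nat_iso_def)
  then have G: "Src G = Src F" "Tgt G = Tgt F" and C: "is_category (Tgt F)" "is_category (Src F)"
    and FG: "is_functor F (Src F) (Tgt F)" "is_functor G (Src F) (Tgt F)"
    by (auto simp: is_nat_def is_functor_def)
  show ?thesis
    unfolding is_nat_def G
  proof (intro conjI ballI)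
    show "Cmp (ninv t) \<in> extensional (Obj (Src F))"
      using t G by (simp add: ninv_def mk_nat_def nat_simps)
    fix f assume "f \<in> Arr (Src F)"
    then have f: "f \<in> hom (Src F) (Dom (Src F) f) (Cod (Src F) f)" by (simp add: hom_def)
    let ?x = "Dom (Src F) f" and ?y = "Cod (Src F) f"
    let ?i = "Cmp (ninv t)" and ?c = "Comp (Tgt F)"
    have x: "?x \<in> Obj (Src F)" and y: "?y \<in> Obj (Src F)" using hom_objs[OF C(2) f] .
    note i = ninv_Cmp[OF assms x] and j = ninv_Cmp[OF assms y]
    note tx = nat_hom[OF t x] and ty = nat_hom[OF t y]
    note Ff = functor_hom[OF FG(1) f] and Gf = functor_hom[OF FG(2) f]
    have "?c (?i ?y) (AMap G f) = ?c (?i ?y) (?c (AMap G f) (?c (Cmp t ?x) (?i ?x)))"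
      using Comp_Id[OF C(1) Gf] i(3) by simp
    also have "\<dots> = ?c (?i ?y) (?c (?c (AMap G f) (Cmp t ?x)) (?i ?x))"
      by (simp add: Comp_assoc[OF C(1) i(1) tx Gf])
    also have "\<dots> = ?c (?i ?y) (?c (?c (Cmp t ?y) (AMap F f)) (?i ?x))"
      by (simp add: nat_natural[OF t f])
    also have "\<dots> = ?c (?c (?i ?y) (Cmp t ?y)) (?c (AMap F f) (?i ?x))"
      by (simp add: Comp_assoc[OF C(1) i(1) Ff ty]
          Comp_assoc[OF C(1) Comp_hom[OF C(1) i(1) Ff] ty j(1)])
    also have "\<dots> = ?c (AMap F f) (?i ?x)"
      using j(2) Comp_Id[OF C(1) Comp_hom[OF C(1) i(1) Ff]] by simp
    finally show "?c (?i ?y) (AMap G f) = ?c (AMap F f) (?i ?x)" .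
  qed (use t FG assms in \<open>auto simp: nat_simps ninv_Cmp(1)\<close>)
qed

section \<open>Transposes and mates\<close>

definition transpose :: "('o1, 'm1, 'o2, 'm2) adjunction \<Rightarrow> 'o2 \<Rightarrow> 'm1 \<Rightarrow> 'm2" where
  "transpose S z g = Comp (Tgt (Lft S)) (Cmp (Counit S) z) (AMap (Lft S) g)"

definition mate ::
  "('o1, 'm1, 'o2, 'm2) adjunction \<Rightarrow> ('o3, 'm3, 'o4, 'm4) adjunction \<Rightarrow>
   ('o1, 'm1, 'o3, 'm3) cfunctor \<Rightarrow> ('o2, 'm2, 'o4, 'm4) cfunctor \<Rightarrow>
   ('o2, 'm2, 'o3, 'm3) nat_trans \<Rightarrow> ('o1, 'm1, 'o4, 'm4) nat_trans"
where
  "mate S S' P Q t =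
     (Counit S' \<rhd> (Q \<odot> Lft S)) \<bullet> ((Lft S' \<lhd> t) \<rhd> Lft S) \<bullet> ((Lft S' \<odot> P) \<lhd> Unit S)"

lemma left_mate_eq: "left_mate \<D> Su Sv p q \<alpha> = mate Su Sv (DFun \<D> p) (DFun \<D> q) (DNat \<D> \<alpha>)"
  by (simp add: left_mate_def mate_def)

lemma morphism_mate_eq:
  "morphism_mate F S T u = mate S T (MFun F (Src u)) (MFun F (Tgt u)) (ninv (MNat F u))"
  by (simp add: morphism_mate_def mate_def)

locale adj =
  fixes S :: "('o1, 'm1, 'o2, 'm2) adjunction" and C D
  assumes adjunction: "is_adjunction S" and Lft: "is_functor (Lft S) C D"
begin

lemma cats: "is_category C" "is_category D" "Src (Lft S) = C" "Tgt (Lft S) = D"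
  using functor_cat[OF Lft] by auto

lemma Rgt: "is_functor (Rgt S) D C"
  using adjunction by (simp add: is_adjunction_def cats)

lemmas Rgt_cats = functor_cat[OF Rgt]

lemma Unit: "is_nat (Unit S) (fid C) (Rgt S \<odot> Lft S)"
  using adjunction by (simp add: is_adjunction_def cats)

lemma Counit: "is_nat (Counit S) (Lft S \<odot> Rgt S) (fid D)"
  using adjunction by (simp add: is_adjunction_def cats)

lemma Unit_hom: "x \<in> Obj C \<Longrightarrow> Cmp (Unit S) x \<in> hom C x (OMap (Rgt S) (OMap (Lft S) x))"
  using nat_hom[OF Unit] by (simp add: cats)

lemma Counit_hom: "x \<in> Obj D \<Longrightarrow> Cmp (Counit S) x \<in> hom D (OMap (Lft S) (OMap (Rgt S) x)) x"
  using nat_hom[OF Counit] by (simp add: cats Rgt_cats)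

lemma triangle:
  assumes "z \<in> Obj D"
  shows "Comp C (AMap (Rgt S) (Cmp (Counit S) z)) (Cmp (Unit S) (OMap (Rgt S) z))
    = Id C (OMap (Rgt S) z)"
proof -
  have "Cmp ((Rgt S \<lhd> Counit S) \<bullet> (Unit S \<rhd> Rgt S)) z = Cmp (nid (Rgt S)) z"
    using adjunction by (simp add: is_adjunction_def)
  then show ?thesis
    using assms by (simp add: nid_def Rgt_cats cats nat_simps[OF Unit] nat_simps[OF Counit])
qed

lemma transpose_hom:
  assumes "z \<in> Obj D" "g \<in> hom C y (OMap (Rgt S) z)"
  shows "transpose S z g \<in> hom D (OMap (Lft S) y) z"
  unfolding transpose_def cats
  by (rule Comp_hom[OF cats(2) functor_hom[OF Lft assms(2)] Counit_hom[OF assms(1)]])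

lemma Comp_transpose:
  assumes "g \<in> hom C y (OMap (Rgt S) z)" "h \<in> hom D z z'"
  shows "Comp D h (transpose S z g) = transpose S z' (Comp C (AMap (Rgt S) h) g)"
proof -
  have z: "z \<in> Obj D" "z' \<in> Obj D" using hom_objs[OF cats(2) assms(2)] .
  note Rh = functor_hom[OF Rgt assms(2)]
  have h: "h \<in> Arr D" using assms(2) by (simp add: hom_def)
  have nat: "Comp D h (Cmp (Counit S) z) = Comp D (Cmp (Counit S) z') (AMap (Lft S) (AMap (Rgt S) h))"
    using nat_natural[OF Counit, of h z z'] assms(2) h by (simp add: Rgt_cats cats)
  show ?thesis
    unfolding transpose_def cats functor_Comp[OF Lft assms(1) Rh]
      Comp_assoc[OF cats(2) functor_hom[OF Lft assms(1)] Counit_hom[OF z(1)] assms(2), symmetric] nat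
    by (rule Comp_assoc[OF cats(2) functor_hom[OF Lft assms(1)] functor_hom[OF Lft Rh]
          Counit_hom[OF z(2)]])
qed

lemma transpose_Comp:
  assumes "z \<in> Obj D" "g \<in> hom C y (OMap (Rgt S) z)" "k \<in> hom C x y"
  shows "Comp D (transpose S z g) (AMap (Lft S) k) = transpose S z (Comp C g k)"
  unfolding transpose_def cats functor_Comp[OF Lft assms(3,2)]
  by (rule Comp_assoc[OF cats(2) functor_hom[OF Lft assms(3)] functor_hom[OF Lft assms(2)]
        Counit_hom[OF assms(1)]])

lemma Rgt_transpose_Unit:
  assumes "z \<in> Obj D" "g \<in> hom C y (OMap (Rgt S) z)"
  shows "Comp C (AMap (Rgt S) (transpose S z g)) (Cmp (Unit S) y) = g"
proof -
  have y: "y \<in> Obj C" and Rz: "OMap (Rgt S) z \<in> Obj C" using hom_objs[OF cats(1) assms(2)] .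
  have g: "g \<in> Arr C" using assms(2) by (simp add: hom_def)
  note Lg = functor_hom[OF Lft assms(2)]
  note RLg = functor_hom[OF Rgt Lg] and Rc = functor_hom[OF Rgt Counit_hom[OF assms(1)]]
  have nat: "Comp C (AMap (Rgt S) (AMap (Lft S) g)) (Cmp (Unit S) y)
      = Comp C (Cmp (Unit S) (OMap (Rgt S) z)) g"
    using nat_natural[OF Unit, of g y "OMap (Rgt S) z"] assms(2) g by (simp add: cats)
  show ?thesis
    unfolding transpose_def cats functor_Comp[OF Rgt Lg Counit_hom[OF assms(1)]]
      Comp_assoc[OF cats(1) Unit_hom[OF y] RLg Rc] nat
      Comp_assoc[OF cats(1) assms(2) Unit_hom[OF Rz] Rc, symmetric] triangle[OF assms(1)]
    by (rule Comp_Id(2)[OF cats(1) assms(2)])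
qed

end

locale mate_square = S: adj S A B + S': adj S' A' B'
  for S :: "('o1, 'm1, 'o2, 'm2) adjunction" and A B
    and S' :: "('o3, 'm3, 'o4, 'm4) adjunction" and A' B' +
  fixes P Q t
  assumes P: "is_functor P A A'" and Q: "is_functor Q B B'"
    and t: "is_nat t (P \<odot> Rgt S) (Rgt S' \<odot> Q)"
begin

lemma mate_ends:
  "NSrc (mate S S' P Q t) = Lft S' \<odot> P" "NTgt (mate S S' P Q t) = Q \<odot> Lft S"
  using fcomp_fid[OF fcomp_functor[OF P S'.Lft]] fid_fcomp[OF fcomp_functor[OF S.Lft Q]]
  by (simp_all add: mate_def nat_simps[OF S.Unit] nat_simps[OF S'.Counit])

lemma t_hom:
  "y \<in> Obj B \<Longrightarrow> Cmp t y \<in> hom A' (OMap P (OMap (Rgt S) y)) (OMap (Rgt S') (OMap Q y))"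
  using nat_hom[OF t, of y] by (simp add: S.Rgt_cats functor_cat[OF P] functor_cat[OF Q])

lemma t_natural:
  assumes "f \<in> hom B x y"
  shows "Comp A' (Cmp t y) (AMap P (AMap (Rgt S) f)) = Comp A' (AMap (Rgt S') (AMap Q f)) (Cmp t x)"
proof -
  have "f \<in> Arr B" using assms by (simp add: hom_def)
  then show ?thesis
    using nat_natural[OF t, of f x y] assms
    by (simp add: S.Rgt_cats functor_cat[OF P] functor_cat[OF Q])
qed

definition pre :: "'o1 \<Rightarrow> 'm3" where
  "pre x = Comp A' (Cmp t (OMap (Lft S) x)) (AMap P (Cmp (Unit S) x))"

lemma pre_hom:
  assumes "x \<in> Obj A"
  shows "pre x \<in> hom A' (OMap P x) (OMap (Rgt S') (OMap Q (OMap (Lft S) x)))"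
  unfolding pre_def
  by (rule Comp_hom[OF S'.cats(1) functor_hom[OF P S.Unit_hom[OF assms]]
        t_hom[OF functor_obj[OF S.Lft assms]]])

lemma mate_Cmp:
  assumes x: "x \<in> Obj A"
  shows "Cmp (mate S S' P Q t) x = transpose S' (OMap Q (OMap (Lft S) x)) (pre x)"
proof -
  have "Cmp (Unit S) x \<in> Arr A" using S.Unit_hom[OF x] by (simp add: hom_def)
  then show ?thesis
    using x functor_obj[OF S.Lft x]
      functor_Comp[OF S'.Lft functor_hom[OF P S.Unit_hom[OF x]] t_hom[OF functor_obj[OF S.Lft x]]]
    by (simp add: mate_def transpose_def pre_def nat_simps[OF S.Unit] nat_simps[OF S'.Counit]
        nat_simps[OF t] S.cats S'.cats S.Rgt_cats functor_cat[OF P] functor_cat[OF Q])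
qed

lemma mate_hom:
  assumes x: "x \<in> Obj A"
  shows "Cmp (mate S S' P Q t) x
    \<in> hom B' (OMap (Lft S') (OMap P x)) (OMap Q (OMap (Lft S) x))"
  unfolding mate_Cmp[OF x]
  by (rule S'.transpose_hom[OF functor_obj[OF Q functor_obj[OF S.Lft x]] pre_hom[OF x]])

lemma Rgt_mate_Unit:
  assumes x: "x \<in> Obj A"
  shows "Comp A' (AMap (Rgt S') (Cmp (mate S S' P Q t) x)) (Cmp (Unit S') (OMap P x)) = pre x"
  unfolding mate_Cmp[OF x]
  by (rule S'.Rgt_transpose_Unit[OF functor_obj[OF Q functor_obj[OF S.Lft x]] pre_hom[OF x]])

end

section \<open>The comparison square\<close>

lemma prederivator_functor:
  "is_prederivator \<D> \<Longrightarrow> small_functor u A B \<Longrightarrow>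
    is_functor (DFun \<D> u) (DCat \<D> B) (DCat \<D> A)"
  by (simp add: is_prederivator_def)

lemma prederivator_fcomp:
  "is_prederivator \<D> \<Longrightarrow> small_functor u A B \<Longrightarrow> small_functor v B C \<Longrightarrow>
    DFun \<D> (v \<odot> u) = DFun \<D> u \<odot> DFun \<D> v"
  unfolding is_prederivator_def by (elim conjE) blast

lemma prederivator_nat:
  "is_prederivator \<D> \<Longrightarrow> small_functor u A B \<Longrightarrow> small_functor u' A B \<Longrightarrow> is_nat s u u' \<Longrightarrow>
    is_nat (DNat \<D> s) (DFun \<D> u) (DFun \<D> u')"
  unfolding is_prederivator_def by (elim conjE) blast

lemma der_morphism_functor:
  "is_der_morphism F \<D> \<E> \<Longrightarrow> small_category A \<Longrightarrow>
    is_functor (MFun F A) (DCat \<D> A) (DCat \<E> A)"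
  by (simp add: is_der_morphism_def)

lemma der_morphism_nat_iso:
  "is_der_morphism F \<D> \<E> \<Longrightarrow> small_functor u A B \<Longrightarrow>
    is_nat_iso (MNat F u) (DFun \<E> u \<odot> MFun F B) (MFun F A \<odot> DFun \<D> u)"
  by (simp add: is_der_morphism_def)

lemma der_morphism_fcomp:
  "is_der_morphism F \<D> \<E> \<Longrightarrow> small_functor u A B \<Longrightarrow> small_functor v B C \<Longrightarrow>
    MNat F (v \<odot> u) = (MNat F u \<rhd> DFun \<D> v) \<bullet> (DFun \<E> u \<lhd> MNat F v)"
  unfolding is_der_morphism_def by (elim conjE) blast

lemma der_morphism_natural:
  "is_der_morphism F \<D> \<E> \<Longrightarrow> small_functor u A B \<Longrightarrow> small_functor u' A B \<Longrightarrow> is_nat s u u' \<Longrightarrow>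
    MNat F u' \<bullet> (DNat \<E> s \<rhd> MFun F B) = (MFun F A \<lhd> DNat \<D> s) \<bullet> MNat F u"
  unfolding is_der_morphism_def by (elim conjE) blast

theorem proposition13p2:
  fixes \<D> :: "('s::universe, 'o1, 'm1) prederivator"
    and \<E> :: "('s, 'o2, 'm2) prederivator"
    and F :: "('s, 'o1, 'm1, 'o2, 'm2) der_morphism"
    and K A M B :: "('s, 's) category"
    and p v u q :: "('s, 's, 's, 's) cfunctor"
    and \<alpha> :: "('s, 's, 's, 's) nat_trans"
    and uD vD :: "('o1, 'm1, 'o1, 'm1) adjunction"
    and uE vE :: "('o2, 'm2, 'o2, 'm2) adjunction"
  assumes "derivator \<D>" and "derivator \<E>" and "is_der_morphism F \<D> \<E>"
    and "small_functor p K A" and "small_functor v K M"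
    and "small_functor u A B" and "small_functor q M B"
    and "is_nat \<alpha> (u \<odot> p) (q \<odot> v)"
    and "left_kan \<D> u uD" and "left_kan \<D> v vD"
    and "left_kan \<E> u uE" and "left_kan \<E> v vE"
  shows
    "(MFun F M \<lhd> left_mate \<D> uD vD p q \<alpha>) \<bullet>
     (morphism_mate F vD vE v \<rhd> DFun \<D> p) \<bullet>
     (Lft vE \<lhd> MNat F p)
     =
     (MNat F q \<rhd> Lft uD) \<bullet>
     (DFun \<E> q \<lhd> morphism_mate F uD uE u) \<bullet>
     (left_mate \<E> uE vE p q \<alpha> \<rhd> MFun F A)"
proof -
  note sf = assms(4-7)
  have sm: "small_category K" "small_category A" "small_category M" "small_category B"
    and fu: "is_functor p K A" "is_functor v K M" "is_functor u A B" "is_functor q M B"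
    using sf by (auto simp: small_functor_def)
  have sc: "small_functor (u \<odot> p) K B" "small_functor (q \<odot> v) K B"
    using sm fcomp_functor[OF fu(1,3)] fcomp_functor[OF fu(2,4)] by (auto simp: small_functor_def)
  have pre: "is_prederivator \<D>" "is_prederivator \<E>"
    using assms(1,2) by (auto simp: derivator_def)
  have DF: "small_functor w X Y \<Longrightarrow> is_functor (DFun \<D> w) (DCat \<D> Y) (DCat \<D> X)"
    and EF: "small_functor w X Y \<Longrightarrow> is_functor (DFun \<E> w) (DCat \<E> Y) (DCat \<E> X)" for w X Y
    using pre by (auto intro: prederivator_functor)
  have Dcomp: "DFun \<D> (u \<odot> p) = DFun \<D> p \<odot> DFun \<D> u" "DFun \<D> (q \<odot> v) = DFun \<D> v \<odot> DFun \<D> q"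
    and Ecomp: "DFun \<E> (u \<odot> p) = DFun \<E> p \<odot> DFun \<E> u" "DFun \<E> (q \<odot> v) = DFun \<E> v \<odot> DFun \<E> q"
    using pre sf by (auto intro: prederivator_fcomp)
  have "is_nat (DNat \<D> \<alpha>) (DFun \<D> (u \<odot> p)) (DFun \<D> (q \<odot> v))"
    and "is_nat (DNat \<E> \<alpha>) (DFun \<E> (u \<odot> p)) (DFun \<E> (q \<odot> v))"
    using pre sc assms(8) by (auto intro: prederivator_nat)
  then have Dal: "is_nat (DNat \<D> \<alpha>) (DFun \<D> p \<odot> DFun \<D> u) (DFun \<D> v \<odot> DFun \<D> q)"
    and Eal: "is_nat (DNat \<E> \<alpha>) (DFun \<E> p \<odot> DFun \<E> u) (DFun \<E> v \<odot> DFun \<E> q)"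
    by (simp_all add: Dcomp Ecomp)
  have MF: "small_category X \<Longrightarrow> is_functor (MFun F X) (DCat \<D> X) (DCat \<E> X)" for X
    using assms(3) by (rule der_morphism_functor)
  have MN: "small_functor w X Y \<Longrightarrow>
      is_nat_iso (MNat F w) (DFun \<E> w \<odot> MFun F Y) (MFun F X \<odot> DFun \<D> w)" for w X Y
    using assms(3) by (rule der_morphism_nat_iso)
  then have MN': "small_functor w X Y \<Longrightarrow>
      is_nat (MNat F w) (DFun \<E> w \<odot> MFun F Y) (MFun F X \<odot> DFun \<D> w)" for w X Y
    by (simp add: is_nat_iso_def)
  have MNcomp: "MNat F (u \<odot> p) = (MNat F p \<rhd> DFun \<D> u) \<bullet> (DFun \<E> p \<lhd> MNat F u)"
    "MNat F (q \<odot> v) = (MNat F v \<rhd> DFun \<D> q) \<bullet> (DFun \<E> v \<lhd> MNat F q)"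
    using assms(3) sf by (auto intro: der_morphism_fcomp)
  have MNal: "MNat F (q \<odot> v) \<bullet> (DNat \<E> \<alpha> \<rhd> MFun F B) = (MFun F K \<lhd> DNat \<D> \<alpha>) \<bullet> MNat F (u \<odot> p)"
    using assms(3,8) sc by (auto intro: der_morphism_natural)
  have kan: "is_adjunction uD" "is_adjunction vD" "is_adjunction uE" "is_adjunction vE"
    and R: "Rgt uD = DFun \<D> u" "Rgt vD = DFun \<D> v" "Rgt uE = DFun \<E> u" "Rgt vE = DFun \<E> v"
    using assms(9-12) by (auto simp: left_kan_def)
  have adjI: "adj S X Y" if "is_adjunction S" "is_functor (Rgt S) Y X" for S X Y
  proof
    show "is_adjunction S" by (rule that)
    then show "is_functor (Lft S) X Y"
      using that(2) unfolding is_adjunction_def is_functor_def by auto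
  qed
  let ?DA = "DCat \<D> A" and ?DB = "DCat \<D> B" and ?DK = "DCat \<D> K" and ?DM = "DCat \<D> M"
  let ?EA = "DCat \<E> A" and ?EB = "DCat \<E> B" and ?EK = "DCat \<E> K" and ?EM = "DCat \<E> M"
  have "adj uD ?DA ?DB" "adj vD ?DK ?DM" and aE: "adj uE ?EA ?EB" "adj vE ?EK ?EM"
    using kan R DF EF sf by (auto intro!: adjI)
  then interpret LD: mate_square uD ?DA ?DB vD ?DK ?DM "DFun \<D> p" "DFun \<D> q" "DNat \<D> \<alpha>"
    unfolding mate_square_def mate_square_axioms_def R using DF sf Dal by blast
  interpret LE: mate_square uE ?EA ?EB vE ?EK ?EM "DFun \<E> p" "DFun \<E> q" "DNat \<E> \<alpha>"
    using aE unfolding mate_square_def mate_square_axioms_def R using EF sf Eal by blast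
  interpret MU: mate_square uD ?DA ?DB uE ?EA ?EB "MFun F A" "MFun F B" "ninv (MNat F u)"
    using LD.S.adj_axioms aE MF sm ninv_nat[OF MN[OF sf(3)]]
    unfolding mate_square_def mate_square_axioms_def R by blast
  interpret MV: mate_square vD ?DK ?DM vE ?EK ?EM "MFun F K" "MFun F M" "ninv (MNat F v)"
    using LD.S'.adj_axioms aE MF sm ninv_nat[OF MN[OF sf(2)]]
    unfolding mate_square_def mate_square_axioms_def R by blast
  note [simp] = functor_cat[OF LD.P] functor_cat[OF LD.Q] functor_cat[OF LE.P] functor_cat[OF LE.Q]
    functor_cat[OF MU.P] functor_cat[OF MU.Q] functor_cat[OF MV.P] functor_cat[OF MV.Q]
    LD.S.cats LD.S'.cats LE.S.cats LE.S'.cats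
    functor_cat[OF LD.S.Rgt[unfolded R]] functor_cat[OF LD.S'.Rgt[unfolded R]]
    functor_cat[OF LE.S.Rgt[unfolded R]] functor_cat[OF LE.S'.Rgt[unfolded R]]
  have mates: "left_mate \<D> uD vD p q \<alpha> = mate uD vD (DFun \<D> p) (DFun \<D> q) (DNat \<D> \<alpha>)"
    "left_mate \<E> uE vE p q \<alpha> = mate uE vE (DFun \<E> p) (DFun \<E> q) (DNat \<E> \<alpha>)"
    "morphism_mate F uD uE u = mate uD uE (MFun F A) (MFun F B) (ninv (MNat F u))"
    "morphism_mate F vD vE v = mate vD vE (MFun F K) (MFun F M) (ninv (MNat F v))"
    by (simp_all add: left_mate_eq morphism_mate_eq functor_cat[OF fu(2)] functor_cat[OF fu(3)])
  let ?LD = "mate uD vD (DFun \<D> p) (DFun \<D> q) (DNat \<D> \<alpha>)"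
    and ?LE = "mate uE vE (DFun \<E> p) (DFun \<E> q) (DNat \<E> \<alpha>)"
    and ?MU = "mate uD uE (MFun F A) (MFun F B) (ninv (MNat F u))"
    and ?MV = "mate vD vE (MFun F K) (MFun F M) (ninv (MNat F v))"
  note ends = LD.mate_ends LE.mate_ends MU.mate_ends MV.mate_ends
    nat_simps[OF MN'[OF sf(1)]] nat_simps[OF MN'[OF sf(4)]]
  have pointwise: "Comp ?EM (AMap (MFun F M) (Cmp ?LD X))
      (Comp ?EM (Cmp ?MV (OMap (DFun \<D> p) X)) (AMap (Lft vE) (Cmp (MNat F p) X)))
    = Comp ?EM (Cmp (MNat F q) (OMap (Lft uD) X))
      (Comp ?EM (AMap (DFun \<E> q) (Cmp ?MU X)) (Cmp ?LE (OMap (MFun F A) X)))"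
    if X: "X \<in> Obj ?DA" for X
  proof -
    let ?c = "Comp ?EK" and ?FX = "OMap (MFun F A) X" and ?W = "OMap (Lft uD) X"
      and ?Y = "OMap (DFun \<D> p) X"
    let ?qW = "OMap (DFun \<D> q) ?W" and ?FW = "OMap (MFun F B) ?W" and ?uW = "OMap (DFun \<D> u) ?W"
    let ?FqW = "OMap (MFun F M) ?qW"
    have W: "?W \<in> Obj ?DB" and Y: "?Y \<in> Obj ?DK" and FX: "?FX \<in> Obj ?EA"
      using functor_obj[OF LD.S.Lft X] functor_obj[OF LD.P X] functor_obj[OF MU.P X] .
    have vY: "OMap (Lft vD) ?Y \<in> Obj ?DM" and qW: "?qW \<in> Obj ?DM" and FW: "?FW \<in> Obj ?EB"
      and uW: "?uW \<in> Obj ?DA"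
      using functor_obj[OF LD.S'.Lft Y] functor_obj[OF LD.Q W] functor_obj[OF MU.Q W]
        functor_obj[OF LD.S.Rgt[unfolded R] W] .
    have FqW: "?FqW \<in> Obj ?EM" by (rule functor_obj[OF MV.Q qW])
    define a where "a = Cmp (MNat F p) X"
    define b where "b = AMap (MFun F K) (AMap (DFun \<D> p) (Cmp (Unit uD) X))"
    define d where "d = AMap (MFun F K) (Cmp (DNat \<D> \<alpha>) ?W)"
    define e where "e = AMap (DFun \<E> p) (AMap (MFun F A) (Cmp (Unit uD) X))"
    define i where "i = Cmp (ninv (MNat F v)) ?qW"
    define j where "j = AMap (DFun \<E> p) (Cmp (ninv (MNat F u)) ?W)"
    define j' where "j' = AMap (DFun \<E> p) (Cmp (MNat F u) ?W)"
    define k where "k = Cmp (MNat F p) ?uW"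
    define l where "l = Cmp (DNat \<E> \<alpha>) ?FW"
    define r where "r = AMap (DFun \<E> v) (Cmp (MNat F q) ?W)"
    define s where "s = Cmp (MNat F v) ?qW"
    let ?o0 = "OMap (DFun \<E> p) ?FX" and ?o1 = "OMap (MFun F K) ?Y"
      and ?o2 = "OMap (MFun F K) (OMap (DFun \<D> p) ?uW)"
      and ?o3 = "OMap (MFun F K) (OMap (DFun \<D> v) ?qW)"
      and ?o4 = "OMap (DFun \<E> v) ?FqW"
      and ?o5 = "OMap (DFun \<E> p) (OMap (MFun F A) ?uW)"
      and ?o6 = "OMap (DFun \<E> p) (OMap (DFun \<E> u) ?FW)"
      and ?o7 = "OMap (DFun \<E> v) (OMap (DFun \<E> q) ?FW)"
    have eta: "Cmp (Unit uD) X \<in> hom ?DA X ?uW" using LD.S.Unit_hom[OF X] by (simp add: R)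
    note gu = ninv_Cmp[OF MN[OF sf(3)], simplified, OF W]
      and gv = ninv_Cmp[OF MN[OF sf(2)], simplified, OF qW]
    have gu': "Cmp (MNat F u) ?W \<in> hom ?EA (OMap (DFun \<E> u) ?FW) (OMap (MFun F A) ?uW)"
      using nat_hom[OF MN'[OF sf(3)], of ?W] W by simp
    have gq: "Cmp (MNat F q) ?W \<in> hom ?EM (OMap (DFun \<E> q) ?FW) ?FqW"
      using nat_hom[OF MN'[OF sf(4)], of ?W] W by simp
    have a: "a \<in> hom ?EK ?o0 ?o1" using nat_hom[OF MN'[OF sf(1)], of X] X by (simp add: a_def)
    have b: "b \<in> hom ?EK ?o1 ?o2"
      unfolding b_def by (intro functor_hom[OF MV.P] functor_hom[OF LD.P] eta)
    have d: "d \<in> hom ?EK ?o2 ?o3"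
      unfolding d_def using functor_hom[OF MV.P LD.t_hom[OF W]] by (simp add: R)
    have e: "e \<in> hom ?EK ?o0 ?o5"
      unfolding e_def by (intro functor_hom[OF LE.P] functor_hom[OF MU.P] eta)
    have i: "i \<in> hom ?EK ?o3 ?o4" unfolding i_def using gv(1) qW by simp
    have j: "j \<in> hom ?EK ?o5 ?o6" unfolding j_def using functor_hom[OF LE.P gu(1)] W by simp
    have j': "j' \<in> hom ?EK ?o6 ?o5" unfolding j'_def by (rule functor_hom[OF LE.P gu'])
    have k: "k \<in> hom ?EK ?o5 ?o2" using nat_hom[OF MN'[OF sf(1)], of ?uW] uW by (simp add: k_def)
    have l: "l \<in> hom ?EK ?o6 ?o7" unfolding l_def using LE.t_hom[OF FW] by (simp add: R)
    have r: "r \<in> hom ?EK ?o7 ?o4"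
      unfolding r_def using functor_hom[OF LE.S'.Rgt gq] by (simp add: R)
    have s: "s \<in> hom ?EK ?o4 ?o3" using nat_hom[OF MN'[OF sf(2)], of ?qW] qW by (simp add: s_def)
    note C = LE.S'.cats(1)
    note co = Comp_hom[OF C] and assoc = Comp_assoc[OF C]
    have ba: "?c b a = ?c k e"
      using nat_natural[OF MN'[OF sf(1)], of _ X ?uW, simplified, OF eta] eta
      by (simp add: a_def b_def e_def k_def hom_def)
    have j'j: "?c j' j = Id ?EK ?o5"
      unfolding j_def j'_def using gu W uW functor_Comp[OF LE.P _ gu', symmetric]
        functor_Id[OF LE.P functor_obj[OF MU.P uW]] by simp
    have i_s: "?c i s = Id ?EK ?o4" unfolding i_def s_def using gv(2) qW by simp
    have srl: "?c d (?c k j') = ?c s (?c r l)"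
    proof -
      have "Cmp (MNat F (q \<odot> v) \<bullet> (DNat \<E> \<alpha> \<rhd> MFun F B)) ?W
          = Cmp ((MFun F K \<lhd> DNat \<D> \<alpha>) \<bullet> MNat F (u \<odot> p)) ?W"
        by (simp add: MNal)
      moreover have "Cmp (MNat F (u \<odot> p)) ?W = ?c k j'" "Cmp (MNat F (q \<odot> v)) ?W = ?c s r"
        using W gu' gq unfolding MNcomp
        by (simp_all add: k_def j'_def s_def r_def nat_simps[OF MN'[OF sf(1)]]
            nat_simps[OF MN'[OF sf(2)]] nat_simps[OF MN'[OF sf(3)]] nat_simps[OF MN'[OF sf(4)]])
      ultimately have "?c (?c s r) l = ?c d (?c k j')"
        using W nat_simps[OF MN'[OF sc(1)]]
        by (simp add: d_def l_def nat_simps[OF Dal] nat_simps[OF Eal] Ecomp)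
      then show ?thesis by (simp add: assoc[OF l r s])
    qed
    have core: "?c i (?c d k) = ?c r (?c l j)"
    proof -
      have "?c d k = ?c d (?c k (?c j' j))" by (simp add: j'j Comp_Id[OF C k])
      also have "\<dots> = ?c (?c d (?c k j')) j"
        by (simp add: assoc[OF j j' k] assoc[OF j co[OF j' k] d])
      also have "\<dots> = ?c s (?c r (?c l j))"
        by (simp add: srl assoc[OF j co[OF l r] s] assoc[OF j l r])
      finally show ?thesis
        using assoc[OF co[OF co[OF j l] r] s i] i_s Comp_Id(2)[OF C co[OF co[OF j l] r]] by simp
    qed
    have LDp: "Cmp ?LD X \<in> hom ?DM (OMap (Lft vD) ?Y) ?qW" by (rule LD.mate_hom[OF X])
    have etaY: "Cmp (Unit vD) ?Y \<in> hom ?DK ?Y (OMap (DFun \<D> v) (OMap (Lft vD) ?Y))"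
      using LD.S'.Unit_hom[OF Y] by (simp add: R)
    note RLD = functor_hom[OF LD.S'.Rgt[unfolded R] LDp]
    note FRLD = functor_hom[OF MV.P RLD] and Feta = functor_hom[OF MV.P etaY]
    note FLD = functor_hom[OF MV.Q LDp] and RFLD = functor_hom[OF LE.S'.Rgt[unfolded R] FLD]
    have iY: "Cmp (ninv (MNat F v)) (OMap (Lft vD) ?Y)
        \<in> hom ?EK (OMap (MFun F K) (OMap (DFun \<D> v) (OMap (Lft vD) ?Y)))
            (OMap (DFun \<E> v) (OMap (MFun F M) (OMap (Lft vD) ?Y)))"
      using MV.t_hom[OF vY] by (simp add: R)
    have left: "?c (AMap (DFun \<E> v) (AMap (MFun F M) (Cmp ?LD X))) (MV.pre ?Y) = ?c i (?c d b)"
    proof -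
      have "?c (AMap (DFun \<E> v) (AMap (MFun F M) (Cmp ?LD X))) (MV.pre ?Y)
          = ?c (?c i (AMap (MFun F K) (AMap (DFun \<D> v) (Cmp ?LD X))))
              (AMap (MFun F K) (Cmp (Unit vD) ?Y))"
        unfolding MV.pre_def i_def
        using assoc[OF Feta iY RFLD] MV.t_natural[OF LDp] by (simp add: R)
      also have "\<dots> = ?c i (AMap (MFun F K) (LD.pre X))"
        using assoc[OF Feta FRLD i] functor_Comp[OF MV.P etaY RLD] LD.Rgt_mate_Unit[OF X]
        by (simp add: R)
      also have "AMap (MFun F K) (LD.pre X) = ?c d b"
        unfolding LD.pre_def d_def b_def
        using functor_Comp[OF MV.P functor_hom[OF LD.P eta], of "Cmp (DNat \<D> \<alpha>) ?W"] LD.t_hom[OF W]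
        by (simp add: R)
      finally show ?thesis .
    qed
    have MUp: "Cmp ?MU X \<in> hom ?EB (OMap (Lft uE) ?FX) ?FW" by (rule MU.mate_hom[OF X])
    have etaFX: "Cmp (Unit uE) ?FX \<in> hom ?EA ?FX (OMap (DFun \<E> u) (OMap (Lft uE) ?FX))"
      using LE.S.Unit_hom[OF FX] by (simp add: R)
    note RMU = functor_hom[OF LE.S.Rgt[unfolded R] MUp]
    note qMU = functor_hom[OF LE.Q MUp]
    have uFX: "OMap (Lft uE) ?FX \<in> Obj ?EB" by (rule functor_obj[OF LE.S.Lft FX])
    note tFX = LE.t_hom[OF uFX, unfolded R]
    have right: "?c (AMap (DFun \<E> v) (AMap (DFun \<E> q) (Cmp ?MU X))) (LE.pre ?FX) = ?c l (?c j e)"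
    proof -
      note p1 = functor_hom[OF LE.P etaFX] and p2 = functor_hom[OF LE.P RMU]
        and v1 = functor_hom[OF LE.S'.Rgt[unfolded R] qMU]
      have "?c (AMap (DFun \<E> v) (AMap (DFun \<E> q) (Cmp ?MU X))) (LE.pre ?FX)
          = ?c (?c l (AMap (DFun \<E> p) (AMap (DFun \<E> u) (Cmp ?MU X))))
              (AMap (DFun \<E> p) (Cmp (Unit uE) ?FX))"
        unfolding LE.pre_def l_def
        using assoc[OF p1 tFX v1] LE.t_natural[OF MUp] by (simp add: R)
      also have "\<dots> = ?c l (AMap (DFun \<E> p) (MU.pre X))"
        using assoc[OF p1 p2 l] functor_Comp[OF LE.P etaFX RMU] MU.Rgt_mate_Unit[OF X]
        by (simp add: R)
      also have "AMap (DFun \<E> p) (MU.pre X) = ?c j e"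
        unfolding MU.pre_def j_def e_def
        using functor_Comp[OF LE.P functor_hom[OF MU.P eta], of "Cmp (ninv (MNat F u)) ?W"]
          MU.t_hom[OF W]
        by (simp add: R)
      finally show ?thesis .
    qed
    note pre1 = MV.pre_hom[OF Y]
    have "Comp ?EM (AMap (MFun F M) (Cmp ?LD X))
        (Comp ?EM (Cmp ?MV ?Y) (AMap (Lft vE) (Cmp (MNat F p) X)))
      = transpose vE ?FqW (?c (AMap (DFun \<E> v) (AMap (MFun F M) (Cmp ?LD X))) (?c (MV.pre ?Y) a))"
      unfolding MV.mate_Cmp[OF Y] a_def[symmetric]
        LE.S'.transpose_Comp[OF functor_obj[OF MV.Q vY] pre1 a]
        LE.S'.Comp_transpose[OF co[OF a pre1] FLD]
      by (simp add: R)
    also have "?c (AMap (DFun \<E> v) (AMap (MFun F M) (Cmp ?LD X))) (?c (MV.pre ?Y) a)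
        = ?c i (?c d (?c b a))"
      using assoc[OF a pre1[unfolded R] RFLD] left assoc[OF a co[OF b d] i] assoc[OF a b d] by simp
    also have "\<dots> = ?c (?c i (?c d k)) e"
      by (simp add: ba assoc[OF e k d] assoc[OF e co[OF k d] i])
    also have "\<dots> = ?c r (?c l (?c j e))"
      by (simp add: core assoc[OF e co[OF j l] r] assoc[OF e j l])
    also have "transpose vE ?FqW (?c r (?c l (?c j e)))
      = Comp ?EM (Cmp (MNat F q) ?W) (transpose vE (OMap (DFun \<E> q) ?FW) (?c l (?c j e)))"
      using LE.S'.Comp_transpose[OF co[OF co[OF e j] l, folded R] gq]
      by (simp add: R r_def)
    also have "transpose vE (OMap (DFun \<E> q) ?FW) (?c l (?c j e))
      = Comp ?EM (AMap (DFun \<E> q) (Cmp ?MU X)) (Cmp ?LE ?FX)"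
      unfolding LE.mate_Cmp[OF FX] right[symmetric]
      using LE.S'.Comp_transpose[OF LE.pre_hom[OF FX] qMU] by (simp add: R)
    finally show ?thesis .
  qed
  show ?thesis
    unfolding mates
  proof (rule vcomp_eqI)
    fix X assume "X \<in> Obj (Src (NSrc ((?MV \<rhd> DFun \<D> p) \<bullet> (Lft vE \<lhd> MNat F p))))"
    then have "X \<in> Obj ?DA" by (simp add: ends)
    then show "Cmp ((MFun F M \<lhd> ?LD) \<bullet> (?MV \<rhd> DFun \<D> p) \<bullet> (Lft vE \<lhd> MNat F p)) X
      = Cmp ((MNat F q \<rhd> Lft uD) \<bullet> (DFun \<E> q \<lhd> ?MU) \<bullet> (?LE \<rhd> MFun F A)) X"
      using pointwise by (simp add: ends)
  qed (simp_all add: ends fcomp_assoc[OF MU.P LE.P] fcomp_assoc[OF LD.S.Lft LD.Q])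
qed

end
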